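(* Let $G$ be a graph on $n$ vertices with combinatorial Laplacian matrix $\mathbf{L}$, let $\varphi_{\mathbf{L}}(\lambda)=\lambda\cdot\xi(\lambda)$ be the characteristic polynomial of $\mathbf{L}$, and let $\mathbf{U}$ be the (orthonormal) eigenvector matrix of $\mathbf{L}$. If $\operatorname{Gal}(\xi)\ge A_{n-1}$, then all minors of $\mathbf{U}$ are nonzero, i.e. $$\|f\|_0+\|\hat f\|_0\ \ge\ n+1$$ for any signal $f\neq 0$ on the graph $G$, where the Graph Fourier transform $\hat f$ is given by $\hat f=\mathbf{U}^{*}f$.
   Context: Graphs are finite and simple, with vertex set $\{1,\dots,n\}$; a signal on $G$ is a vector $f\in\mathbb{R}^n$. The combinatorial Laplacian is $\mathbf{L}=\mathbf{D}-\mathbf{A}\in\mathbb{Z}^{n\times n}$, where $\mathbf{A}$ is the $0/1$ adjacency matrix and $\mathbf{D}$ is the diagonal matrix of vertex degrees. The orthonormal eigenvector matrix $\mathbf{U}\in\mathbb{R}^{n\times n}$ has as columns an orthonormal basis of eigenvectors of $\mathbf{L}$. A minor is the determinant of a square submatrix of any size (arbitrary row and column index sets of equal size). $\operatorname{Gal}(\xi)=\operatorname{Aut}_{\mathbb{Q}}(F)$, with $F$ the splitting field of $\xi$ over $\mathbb{Q}$, is viewed as a permutation group on the $n-1$ (pairwise distinct) roots of $\xi$, and $\operatorname{Gal}(\xi)\ge A_{n-1}$ means that this group contains the alternating group $A_{n-1}$. $\|f\|_0$ denotes the number of nonzero entries of $f$.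
   Formalization: Graphs with n = 3 and the edgeless graph with n = 2 are excluded: there A_{n-1} is trivial and the claim fails (for the path on 3 vertices the eigenvector (1,0,-1)/√2 has a zero entry; for the edgeless graph on 2 vertices take U = I). *)

theory Defs
  imports
    "Jordan_Normal_Form.Char_Poly"
    "Jordan_Normal_Form.DL_Submatrix"
    "Graph_Theory.Pair_Digraph"
    "HOL-Algebra.Generated_Fields"
    "HOL-Algebra.Algebraic_Closure_Type"
    "HOL-Combinatorics.Permutations"
begin

text \<open>
  A finite simple graph is a \<open>pair_graph\<close>: finite, loop-free, and with a symmetric arc set, so an
  edge is a pair of opposite arcs and the degree of a vertex is its out-degree. The vertices
  are \<open>0, \<dots>, n - 1\<close>, to agree with the indices of matrices.
\<close>

definition adjacency_mat :: "nat \<Rightarrow> nat pair_pre_digraph \<Rightarrow> int mat" where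
  "adjacency_mat n G = mat n n (\<lambda>(i, j). if (i, j) \<in> parcs G then 1 else 0)"

definition degree_mat :: "nat \<Rightarrow> nat pair_pre_digraph \<Rightarrow> int mat" where
  "degree_mat n G = mat n n (\<lambda>(i, j). if i = j then int (out_degree (with_proj G) i) else 0)"

definition laplacian_mat :: "nat \<Rightarrow> nat pair_pre_digraph \<Rightarrow> int mat" where
  "laplacian_mat n G = degree_mat n G - adjacency_mat n G"

text \<open>The \<open>n\<close> orthonormal columns automatically form a basis of the \<open>n\<close>-dimensional space.\<close>

definition orthonormal_eigenvector_mat :: "nat \<Rightarrow> real mat \<Rightarrow> real mat \<Rightarrow> bool" where
  "orthonormal_eigenvector_mat n L U \<longleftrightarrow>
     U \<in> carrier_mat n n \<and>
     (\<forall>i<n. \<forall>j<n. col U i \<bullet> col U j = (if i = j then 1 else 0)) \<and>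
     (\<forall>j<n. \<exists>\<mu>. eigenvector L (col U j) \<mu>)"

definition norm0 :: "real vec \<Rightarrow> nat" where
  "norm0 f = card {i. i < dim_vec f \<and> f $ i \<noteq> 0}"

definition graph_fourier :: "real mat \<Rightarrow> real vec \<Rightarrow> real vec" where
  "graph_fourier U f = transpose_mat U *\<^sub>v f"

definition complex_roots :: "rat poly \<Rightarrow> complex set" where
  "complex_roots p = {z. poly (map_poly of_rat p) z = 0}"

definition splitting_field :: "rat poly \<Rightarrow> complex ring" where
  "splitting_field p = ring_of_type_algebra
     \<lparr> carrier := generate_field ring_of_type_algebra (\<rat> \<union> complex_roots p) \<rparr>"

text \<open>
  Membership in \<open>extensional\<close> fixes the arbitrary values outside the splitting field, so that
  each automorphism is represented by exactly one function.
\<close>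

definition galois_group :: "rat poly \<Rightarrow> (complex \<Rightarrow> complex) set" where
  "galois_group p =
     {\<sigma> \<in> ring_iso (splitting_field p) (splitting_field p).
        \<sigma> \<in> extensional (carrier (splitting_field p)) \<and> (\<forall>q\<in>\<rat>. \<sigma> q = q)}"

definition galois_perms :: "rat poly \<Rightarrow> (complex \<Rightarrow> complex) set" where
  "galois_perms p = (\<lambda>\<sigma>. restrict_id \<sigma> (complex_roots p)) ` galois_group p"

text \<open>
  The alternating group on an arbitrary set; the library's \<open>alt_group\<close> acts on \<open>{1..n}\<close> only.
\<close>

definition alternating_perms :: "'a set \<Rightarrow> ('a \<Rightarrow> 'a) set" where
  "alternating_perms A = {\<pi>. \<pi> permutes A \<and> evenperm \<pi>}"

end

theory Submission
  imports Defs
begin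

text \<open>
  Write \<open>\<lambda>\<^sub>j\<close> for the eigenvalue of the \<open>j\<close>-th column of \<open>U\<close>. The minor of \<open>U\<close> with rows \<open>I\<close> and
  columns \<open>J\<close> depends on the choice of signs of the columns, but its vanishing is an algebraic
  property of the set \<open>S = {\<lambda>\<^sub>j | j \<in> J}\<close> alone: with \<open>h\<close> the monic polynomial whose roots are the
  eigenvalues outside \<open>S\<close>, spectral decomposition gives
  \<open>h(L) = \<Sum>j\<in>J. h(\<lambda>\<^sub>j) u\<^sub>j u\<^sub>j\<^sup>T\<close>, so the principal minor of \<open>h(L)\<close> with index set \<open>I\<close> is the
  square of the minor of \<open>U\<close> times the nonzero number \<open>\<Prod>j\<in>J. h(\<lambda>\<^sub>j)\<close> (\<open>det_poly_mat_eq_minor\<close>).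
  Since \<open>L\<close> is integral, an automorphism \<open>\<sigma>\<close> takes this principal minor for \<open>S\<close> to the one for
  \<open>\<sigma>(S)\<close>; hence the minors of \<open>U\<close> belonging to \<open>S\<close> and to \<open>\<sigma>(S)\<close> vanish together
  (\<open>minor_zero_conjugate\<close>).

  The alternating group on a set whose size is not \<open>2\<close> moves any subset to any other subset of the
  same size (\<open>alternating_perms_homogeneous\<close>). So \<open>0\<close>, which every automorphism fixes, cannot be one
  of several roots of \<open>\<xi>\<close>, and as the only root it would force \<open>L = 0\<close>; hence \<open>L\<close> has \<open>n\<close> distinct
  eigenvalues. If one minor with rows \<open>I\<close> vanished,
  then so would all minors with rows \<open>I\<close> and the same number of columns that agree with it on whether
  the column of the eigenvalue \<open>0\<close> is used. But each of the two classes contains a nonzero minor: the rows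
  of \<open>U\<close> are independent, the column of the eigenvalue \<open>0\<close> is a nonzero constant vector, and a
  combination of fewer than \<open>n\<close> rows that vanishes in all other columns would be a multiple of that
  constant vector (\<open>exists_nonzero_minor_UNIV\<close>, \<open>exists_nonzero_minor_avoiding\<close>).

  The uncertainty inequality is a reformulation: if the support \<open>I\<close> of \<open>f\<close> were at most as large as
  the zero set of the transform, some square submatrix of \<open>U\<close> with rows \<open>I\<close> would annihilate the
  restriction of \<open>f\<close> to \<open>I\<close> (\<open>uncertainty_of_nonzero_minors\<close>).
\<close>

section \<open>Ring homomorphisms on a subset of a ring\<close>

text \<open>
  A Galois automorphism is meaningful only on the splitting field, while matrices and polynomials have
  entries in a whole type. The locale lets determinants and coefficients be computed in the type and
  transported as long as everything stays inside \<open>K\<close>.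
\<close>

locale partial_ring_hom =
  fixes K :: "'a::comm_ring_1 set" and \<sigma> :: "'a \<Rightarrow> 'b::comm_ring_1"
  assumes one_closed: "1 \<in> K"
    and uminus_closed: "x \<in> K \<Longrightarrow> - x \<in> K"
    and add_closed: "x \<in> K \<Longrightarrow> y \<in> K \<Longrightarrow> x + y \<in> K"
    and mult_closed: "x \<in> K \<Longrightarrow> y \<in> K \<Longrightarrow> x * y \<in> K"
    and hom_one: "\<sigma> 1 = 1"
    and hom_add: "x \<in> K \<Longrightarrow> y \<in> K \<Longrightarrow> \<sigma> (x + y) = \<sigma> x + \<sigma> y"
    and hom_mult: "x \<in> K \<Longrightarrow> y \<in> K \<Longrightarrow> \<sigma> (x * y) = \<sigma> x * \<sigma> y"
begin

lemma zero_closed: "0 \<in> K"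
  using add_closed[OF one_closed uminus_closed[OF one_closed]] by simp

lemma hom_zero: "\<sigma> 0 = 0"
  using hom_add[OF zero_closed zero_closed] by simp

lemma hom_uminus: "x \<in> K \<Longrightarrow> \<sigma> (- x) = - \<sigma> x"
  using hom_add[of x "- x"] by (simp add: uminus_closed hom_zero eq_neg_iff_add_eq_0 add.commute)

lemma diff_closed: "x \<in> K \<Longrightarrow> y \<in> K \<Longrightarrow> x - y \<in> K"
  and hom_diff: "x \<in> K \<Longrightarrow> y \<in> K \<Longrightarrow> \<sigma> (x - y) = \<sigma> x - \<sigma> y"
  using add_closed[of x "- y"] hom_add[of x "- y"] by (auto simp: uminus_closed hom_uminus)

lemma sum_closed: "(\<And>i. i \<in> A \<Longrightarrow> f i \<in> K) \<Longrightarrow> sum f A \<in> K"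
  by (induction A rule: infinite_finite_induct) (auto simp: zero_closed add_closed)

lemma hom_sum: "(\<And>i. i \<in> A \<Longrightarrow> f i \<in> K) \<Longrightarrow> \<sigma> (sum f A) = (\<Sum>i\<in>A. \<sigma> (f i))"
  by (induction A rule: infinite_finite_induct) (auto simp: hom_zero hom_add sum_closed)

lemma prod_closed: "(\<And>i. i \<in> A \<Longrightarrow> f i \<in> K) \<Longrightarrow> prod f A \<in> K"
  by (induction A rule: infinite_finite_induct) (auto simp: one_closed mult_closed)

lemma hom_prod: "(\<And>i. i \<in> A \<Longrightarrow> f i \<in> K) \<Longrightarrow> \<sigma> (prod f A) = (\<Prod>i\<in>A. \<sigma> (f i))"
  by (induction A rule: infinite_finite_induct) (auto simp: hom_one hom_mult prod_closed)

lemma of_nat_closed_hom: "of_nat m \<in> K \<and> \<sigma> (of_nat m) = of_nat m"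
  by (induction m) (auto simp: zero_closed hom_zero add_closed one_closed hom_add hom_one)

lemma of_int_closed: "of_int z \<in> K" and hom_of_int: "\<sigma> (of_int z) = of_int z"
  by (cases z rule: int_cases2, auto simp: of_nat_closed_hom uminus_closed hom_uminus)+

lemma hom_det:
  assumes "A \<in> carrier_mat n n" "\<And>i j. i < n \<Longrightarrow> j < n \<Longrightarrow> A $$ (i, j) \<in> K"
  shows "\<sigma> (det A) = det (map_mat \<sigma> A)"
proof -
  have entry: "A $$ (i, p i) \<in> K" if "p permutes {0..<n}" "i \<in> {0..<n}" for p i
    using that assms(2)[of i "p i"] permutes_in_image[OF that(1)] by auto
  have pr: "(\<Prod>i = 0..<n. A $$ (i, p i)) \<in> K" if "p permutes {0..<n}" for p
    using entry[OF that] by (intro prod_closed) auto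
  have sgn: "of_int (sign p) \<in> K" for p by (rule of_int_closed)
  have "\<sigma> (det A) = (\<Sum>p | p permutes {0..<n}. \<sigma> (of_int (sign p) * (\<Prod>i = 0..<n. A $$ (i, p i))))"
    unfolding det_def'[OF assms(1)]
    by (intro hom_sum mult_closed sgn pr) auto
  also have "\<dots> = (\<Sum>p | p permutes {0..<n}. of_int (sign p) * (\<Prod>i = 0..<n. map_mat \<sigma> A $$ (i, p i)))"
  proof (rule sum.cong[OF refl])
    fix p assume "p \<in> {p. p permutes {0..<n}}"
    hence p: "p permutes {0..<n}" by simp
    have "\<sigma> (\<Prod>i = 0..<n. A $$ (i, p i)) = (\<Prod>i = 0..<n. \<sigma> (A $$ (i, p i)))"
      using entry[OF p] by (intro hom_prod) auto
    also have "\<dots> = (\<Prod>i = 0..<n. map_mat \<sigma> A $$ (i, p i))"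
      using assms(1) permutes_in_image[OF p] by (intro prod.cong) auto
    finally show "\<sigma> (of_int (sign p) * (\<Prod>i = 0..<n. A $$ (i, p i)))
        = of_int (sign p) * (\<Prod>i = 0..<n. map_mat \<sigma> A $$ (i, p i))"
      by (simp add: hom_mult[OF sgn pr[OF p]] hom_of_int)
  qed
  also have "\<dots> = det (map_mat \<sigma> A)"
    using assms(1) by (subst det_def'[of _ n]) auto
  finally show ?thesis .
qed

text \<open>
  Symmetric functions of \<open>E\<close> are taken to the same functions of \<open>\<sigma> ` E\<close>; injectivity keeps the
  product over the image from losing factors.
\<close>

lemma hom_coeff_prod_linear:
  assumes "finite E" "E \<subseteq> K" "inj_on \<sigma> E"
  shows "Polynomial.coeff (\<Prod>\<nu>\<in>E. [:- \<nu>, 1:]) m \<in> K"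
    and "\<sigma> (Polynomial.coeff (\<Prod>\<nu>\<in>E. [:- \<nu>, 1:]) m) = Polynomial.coeff (\<Prod>\<nu>\<in>\<sigma> ` E. [:- \<nu>, 1:]) m"
proof -
  have "Polynomial.coeff (\<Prod>\<nu>\<in>E. [:- \<nu>, 1:]) m \<in> K \<and>
    \<sigma> (Polynomial.coeff (\<Prod>\<nu>\<in>E. [:- \<nu>, 1:]) m) = Polynomial.coeff (\<Prod>\<nu>\<in>\<sigma> ` E. [:- \<nu>, 1:]) m"
    using assms
  proof (induction E arbitrary: m rule: finite_induct)
    case empty
    show ?case by (cases m) (auto simp: one_closed zero_closed hom_one hom_zero)
  next
    case (insert a E)
    have a: "a \<in> K" and new: "\<sigma> a \<notin> \<sigma> ` E" using insert.prems insert.hyps by auto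
    let ?p = "\<Prod>\<nu>\<in>E. [:- \<nu>, 1:]" and ?q = "\<Prod>\<nu>\<in>\<sigma> ` E. [:- \<nu>, 1:]"
    have IH: "Polynomial.coeff ?p i \<in> K" "\<sigma> (Polynomial.coeff ?p i) = Polynomial.coeff ?q i" for i
      using insert.IH[of i] insert.prems by auto
    have p: "(\<Prod>\<nu>\<in>insert a E. [:- \<nu>, 1:]) = [:- a, 1:] * ?p"
      using insert.hyps by simp
    have q: "(\<Prod>\<nu>\<in>\<sigma> ` insert a E. [:- \<nu>, 1:]) = [:- \<sigma> a, 1:] * ?q"
      using insert.hyps new by simp
    show ?case unfolding p q
      by (cases m) (auto simp: coeff_pCons IH a hom_mult hom_uminus hom_diff mult_closed uminus_closed diff_closed)
  qed
  thus "Polynomial.coeff (\<Prod>\<nu>\<in>E. [:- \<nu>, 1:]) m \<in> K"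
    and "\<sigma> (Polynomial.coeff (\<Prod>\<nu>\<in>E. [:- \<nu>, 1:]) m) = Polynomial.coeff (\<Prod>\<nu>\<in>\<sigma> ` E. [:- \<nu>, 1:]) m" by auto
qed

end

section \<open>Extending a nonzero minor\<close>

text \<open>
  Border the given minor by row \<open>m\<close> and a column \<open>j\<close>, and expand along that column. The cofactors do
  not involve \<open>j\<close>, and the last of them is the given minor. If the bordered determinant vanished for
  every \<open>j\<close>, the cofactors would be a linear relation between the rows \<open>0, \<dots>, m\<close> in all columns of
  \<open>T\<close>, with a nonzero coefficient at row \<open>m\<close>.
\<close>

lemma extend_nonzero_minor:
  fixes V :: "nat \<Rightarrow> 'j \<Rightarrow> 'a::idom"
  assumes minor: "det (mat m m (\<lambda>(a, b). V a (f b))) \<noteq> 0"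
    and indep: "\<And>c. (\<And>j. j \<in> T \<Longrightarrow> (\<Sum>a\<le>m. c a * V a j) = 0) \<Longrightarrow> c m = 0"
  shows "\<exists>j\<in>T. det (mat (Suc m) (Suc m) (\<lambda>(a, b). V a ((f(m := j)) b))) \<noteq> 0"
proof (rule ccontr)
  assume no: "\<not> ?thesis"
  define M where "M j = mat (Suc m) (Suc m) (\<lambda>(a, b). V a ((f(m := j)) b))" for j
  (* Column m is deleted in these cofactors, so the column chosen here is irrelevant. *)
  define c where "c a = cofactor (M undefined) a m" for a
  have del: "mat_delete (M j) a m = mat_delete (M undefined) a m" for a j
    by (rule eq_matI) (auto simp: M_def mat_delete_def)
  have "(\<Sum>a\<le>m. c a * V a j) = 0" if "j \<in> T" for j
  proof -
    have "det (M j) = (\<Sum>a<Suc m. M j $$ (a, m) * cofactor (M j) a m)"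
      by (rule laplace_expansion_column) (auto simp: M_def)
    also have "\<dots> = (\<Sum>a\<le>m. c a * V a j)"
    proof (rule sum.cong)
      fix a assume "a \<in> {..m}"
      hence "M j $$ (a, m) = V a j" by (simp add: M_def)
      thus "M j $$ (a, m) * cofactor (M j) a m = c a * V a j"
        by (simp add: c_def cofactor_def del[of j])
    qed auto
    finally show ?thesis using no that by (auto simp: M_def)
  qed
  hence "c m = 0" by (rule indep)
  moreover have "mat_delete (M undefined) m m = mat m m (\<lambda>(a, b). V a (f b))"
    by (rule eq_matI) (auto simp: M_def mat_delete_def)
  ultimately show False using minor by (simp add: c_def cofactor_def)
qed

text \<open>
  Growing a minor one row at a time never changes the columns already chosen, which allows a
  prescribed column to be kept.
\<close>

lemma exists_nonzero_minor:
  fixes V :: "nat \<Rightarrow> 'j \<Rightarrow> 'a::idom"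
  assumes "det (mat l l (\<lambda>(a, b). V a (f0 b))) \<noteq> 0" "f0 ` {..<l} \<subseteq> T" "l \<le> k"
    and "\<And>m c. m < k \<Longrightarrow> (\<And>j. j \<in> T \<Longrightarrow> (\<Sum>a\<le>m. c a * V a j) = 0) \<Longrightarrow> c m = 0"
  shows "\<exists>f. f ` {..<k} \<subseteq> T \<and> (\<forall>i<l. f i = f0 i) \<and> det (mat k k (\<lambda>(a, b). V a (f b))) \<noteq> 0"
  using assms(3,4)
proof (induction k rule: dec_induct)
  case base
  thus ?case using assms(1,2) by blast
next
  case (step k)
  obtain f where f: "f ` {..<k} \<subseteq> T" "\<forall>i<l. f i = f0 i" "det (mat k k (\<lambda>(a, b). V a (f b))) \<noteq> 0"
    using step.IH step.prems by (metis less_SucI)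
  have "\<exists>j\<in>T. det (mat (Suc k) (Suc k) (\<lambda>(a, b). V a ((f(k := j)) b))) \<noteq> 0"
    by (rule extend_nonzero_minor[where V = V and f = f, OF f(3)]) (use step.prems in blast)
  then obtain j where j: "j \<in> T" "det (mat (Suc k) (Suc k) (\<lambda>(a, b). V a ((f(k := j)) b))) \<noteq> 0" by blast
  show ?case
    by (rule exI[of _ "f(k := j)"]) (use f j step.hyps in \<open>auto simp: lessThan_Suc\<close>)
qed

lemma inj_on_nonzero_minor:
  fixes V :: "nat \<Rightarrow> 'j \<Rightarrow> 'a::idom"
  assumes "det (mat k k (\<lambda>(a, b). V a (f b))) \<noteq> 0"
  shows "inj_on f {..<k}"
proof (rule inj_onI, rule ccontr)
  fix i j assume ij: "i \<in> {..<k}" "j \<in> {..<k}" "f i = f j" "i \<noteq> j"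
  let ?A = "mat k k (\<lambda>(a, b). V a (f b))"
  have "det (transpose_mat ?A) = 0"
    by (rule det_identical_rows[of _ k i j]) (use ij in \<open>auto intro!: eq_vecI\<close>)
  thus False using assms det_transpose[of ?A k] by auto
qed

section \<open>Homogeneity of alternating groups\<close>

lemma exists_permutes_image_eq:
  assumes "finite R" "S \<subseteq> R" "S' \<subseteq> R" "card S = card S'"
  obtains p where "p permutes R" "p ` S = S'"
proof -
  have fin: "finite S" "finite S'" using assms finite_subset by auto
  obtain f where f: "bij_betw f S S'"
    using finite_same_card_bij[OF fin assms(4)] by blast
  have "card (R - S) = card (R - S')"
    using assms fin by (simp add: card_Diff_subset)
  then obtain g where g: "bij_betw g (R - S) (R - S')"
    using finite_same_card_bij[of "R - S" "R - S'"] assms(1) by auto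
  define p where "p x = (if x \<in> S then f x else if x \<in> R then g x else x)" for x
  have pS: "bij_betw p S S'" using f by (subst bij_betw_cong[where g = f]) (auto simp: p_def)
  have pC: "bij_betw p (R - S) (R - S')"
    using g by (subst bij_betw_cong[where g = g]) (auto simp: p_def)
  have "bij_betw p (S \<union> (R - S)) (S' \<union> (R - S'))"
    by (rule bij_betw_combine[OF pS pC]) auto
  moreover have "S \<union> (R - S) = R" "S' \<union> (R - S') = R" using assms by auto
  ultimately have "p permutes R"
    using assms(2) by (intro bij_imp_permutes) (auto simp: p_def)
  thus ?thesis using that pS by (auto simp: bij_betw_def)
qed

text \<open>
  An odd permutation taking \<open>S\<close> to \<open>S'\<close> becomes even after a transposition that preserves \<open>S\<close>, and
  such a transposition exists as soon as \<open>S\<close> or its complement has two elements. This fails only for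
  \<open>card R \<le> 2\<close>; a set with at most one element has no odd permutation, and for two elements the
  statement is false.
\<close>

lemma alternating_perms_homogeneous:
  assumes R: "finite R" "card R \<noteq> 2" and S: "S \<subseteq> R" "S' \<subseteq> R" "card S = card S'"
  shows "\<exists>p\<in>alternating_perms R. p ` S = S'"
proof -
  obtain p where p: "p permutes R" "p ` S = S'"
    using exists_permutes_image_eq[OF R(1) S] .
  have perm: "permutation p" using R(1) p(1) permutation_permutes by blast
  have fin: "finite S" using R S finite_subset by auto
  show ?thesis
  proof (cases "evenperm p \<or> card R \<le> 1")
    case True
    show ?thesis
    proof (cases "evenperm p")
      case True
      thus ?thesis using p by (auto simp: alternating_perms_def)
    next
      case False
      hence "card R \<le> 1" using True by simp
      hence "p = id" using p(1) R(1)
        by (metis card_le_Suc0_iff_eq One_nat_def permutes_not_in permutes_in_image eq_id_iff)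
      thus ?thesis using False by simp
    qed
  next
    case False
    hence odd: "\<not> evenperm p" and "card R \<ge> 3" using R(2) by auto
    hence "card S \<ge> 2 \<or> card (R - S) \<ge> 2"
      using S(1) fin by (auto simp: card_Diff_subset)
    then obtain a b where ab: "a \<noteq> b" "{a, b} \<subseteq> S \<or> {a, b} \<subseteq> R - S"
      by (metis card_2_iff obtain_subset_with_card_n)
    let ?t = "Transposition.transpose a b"
    have t: "?t permutes R" using ab S(1) by (auto intro: permutes_swap_id)
    have tS: "?t ` S = S"
      using ab by (auto simp: image_iff Transposition.transpose_def) 
    have "evenperm (p \<circ> ?t)"
      using odd ab(1) by (simp add: evenperm_comp[OF perm permutation_swap_id] evenperm_swap)
    moreover have "(p \<circ> ?t) permutes R" by (rule permutes_compose[OF t p(1)])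
    moreover have "(p \<circ> ?t) ` S = S'" by (simp only: image_comp[symmetric] tS p(2))
    ultimately show ?thesis by (auto simp: alternating_perms_def)
  qed
qed

section \<open>Minors of an orthonormal eigenvector matrix\<close>

text \<open>
  The evaluation \<open>p(L)\<close>, written by entries because the entries, integral combinations of the
  coefficients of \<open>p\<close>, are what a partial homomorphism acts on.
\<close>

definition poly_mat :: "'a::comm_ring_1 poly \<Rightarrow> int mat \<Rightarrow> 'a mat" where
  "poly_mat p L = mat (dim_row L) (dim_row L)
     (\<lambda>(r, s). \<Sum>m\<le>Polynomial.degree p. Polynomial.coeff p m * of_int ((L ^\<^sub>m m) $$ (r, s)))"

lemma (in partial_ring_hom) hom_poly_mat:
  assumes "Polynomial.degree q = Polynomial.degree p" "r < dim_row L" "s < dim_row L"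
    and "\<And>m. Polynomial.coeff p m \<in> K" "\<And>m. \<sigma> (Polynomial.coeff p m) = Polynomial.coeff q m"
  shows "poly_mat p L $$ (r, s) \<in> K"
    and "\<sigma> (poly_mat p L $$ (r, s)) = poly_mat q L $$ (r, s)"
proof -
  have entry: "poly_mat p L $$ (r, s)
      = (\<Sum>m\<le>Polynomial.degree p. Polynomial.coeff p m * of_int ((L ^\<^sub>m m) $$ (r, s)))"
    using assms(2,3) by (simp add: poly_mat_def)
  have closed: "Polynomial.coeff p m * of_int z \<in> K" for m z
    by (intro mult_closed of_int_closed assms(4))
  show "poly_mat p L $$ (r, s) \<in> K"
    unfolding entry by (intro sum_closed closed)
  show "\<sigma> (poly_mat p L $$ (r, s)) = poly_mat q L $$ (r, s)"
    unfolding entry using assms(1-3)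
    by (simp add: hom_sum[OF closed] hom_mult[OF assms(4) of_int_closed] hom_of_int assms(5) poly_mat_def)
qed

locale orthonormal_eigenbasis =
  fixes n :: nat and L :: "int mat" and U :: "real mat" and \<mu> :: "nat \<Rightarrow> real"
  assumes L_carrier: "L \<in> carrier_mat n n" and U_carrier: "U \<in> carrier_mat n n"
    and cols_orthonormal: "i < n \<Longrightarrow> j < n \<Longrightarrow>
          (\<Sum>s<n. U $$ (s, i) * U $$ (s, j)) = (if i = j then 1 else 0)"
    and eigen: "r < n \<Longrightarrow> j < n \<Longrightarrow>
          (\<Sum>s<n. of_int (L $$ (r, s)) * U $$ (s, j)) = \<mu> j * U $$ (r, j)"
begin

lemma transpose_mult_self: "transpose_mat U * U = 1\<^sub>m n"
  and mult_transpose_self: "U * transpose_mat U = 1\<^sub>m n"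
proof -
  show left: "transpose_mat U * U = 1\<^sub>m n"
    using U_carrier cols_orthonormal
    by (intro eq_matI) (auto simp: scalar_prod_def atLeast0LessThan)
  show "U * transpose_mat U = 1\<^sub>m n"
    using mat_mult_left_right_inverse[OF _ U_carrier left] U_carrier by simp
qed

lemma rows_orthonormal:
  assumes "r < n" "s < n"
  shows "(\<Sum>j<n. U $$ (r, j) * U $$ (s, j)) = (if r = s then 1 else 0)"
proof -
  have "(U * transpose_mat U) $$ (r, s) = (1\<^sub>m n :: real mat) $$ (r, s)"
    by (simp only: mult_transpose_self)
  thus ?thesis using assms U_carrier by (simp add: scalar_prod_def atLeast0LessThan)
qed

lemma spectral_entry:
  assumes "r < n" "s < n"
  shows "of_int (L $$ (r, s)) = (\<Sum>j<n. \<mu> j * U $$ (r, j) * U $$ (s, j))"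
proof -
  have "of_int (L $$ (r, s)) = (\<Sum>t<n. if t = s then real_of_int (L $$ (r, t)) else 0)"
    using assms by simp
  also have "\<dots> = (\<Sum>t<n. of_int (L $$ (r, t)) * (\<Sum>j<n. U $$ (t, j) * U $$ (s, j)))"
    using assms by (intro sum.cong) (auto simp: rows_orthonormal)
  also have "\<dots> = (\<Sum>j<n. (\<Sum>t<n. of_int (L $$ (r, t)) * U $$ (t, j)) * U $$ (s, j))"
    by (simp add: sum_distrib_left sum_distrib_right mult.assoc) (rule sum.swap)
  also have "\<dots> = (\<Sum>j<n. \<mu> j * U $$ (r, j) * U $$ (s, j))"
    using assms by (intro sum.cong) (auto simp: eigen)
  finally show ?thesis .
qed

lemma spectral_entry_pow:
  assumes "r < n" "s < n"
  shows "of_int ((L ^\<^sub>m m) $$ (r, s)) = (\<Sum>j<n. \<mu> j ^ m * U $$ (r, j) * U $$ (s, j))"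
  using assms
proof (induction m arbitrary: s)
  case 0
  thus ?case using L_carrier by (simp add: rows_orthonormal)
next
  case (Suc m)
  have eigen': "(\<Sum>t<n. U $$ (t, j) * of_int (L $$ (t, s))) = \<mu> j * U $$ (s, j)" if "j < n" for j
  proof -
    have "of_int (L $$ (t, s)) = real_of_int (L $$ (s, t))" if "t < n" for t
      using that Suc.prems by (simp add: spectral_entry mult.assoc mult.left_commute mult.commute)
    hence "(\<Sum>t<n. U $$ (t, j) * of_int (L $$ (t, s))) = (\<Sum>t<n. of_int (L $$ (s, t)) * U $$ (t, j))"
      by (intro sum.cong) auto
    thus ?thesis using eigen[OF Suc.prems(2) that] by simp
  qed
  have carr: "L ^\<^sub>m m \<in> carrier_mat n n" using L_carrier by (rule pow_carrier_mat)
  have "real_of_int ((L ^\<^sub>m Suc m) $$ (r, s)) = (\<Sum>t<n. of_int ((L ^\<^sub>m m) $$ (r, t)) * of_int (L $$ (t, s)))"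
    using L_carrier carr Suc.prems by (simp add: scalar_prod_def atLeast0LessThan)
  also have "\<dots> = (\<Sum>t<n. (\<Sum>j<n. \<mu> j ^ m * U $$ (r, j) * U $$ (t, j)) * of_int (L $$ (t, s)))"
    using Suc by (intro sum.cong) auto
  also have "\<dots> = (\<Sum>j<n. \<mu> j ^ m * U $$ (r, j) * (\<Sum>t<n. U $$ (t, j) * of_int (L $$ (t, s))))"
    by (simp add: sum_distrib_left sum_distrib_right mult.assoc) (rule sum.swap)
  also have "\<dots> = (\<Sum>j<n. \<mu> j ^ Suc m * U $$ (r, j) * U $$ (s, j))"
    by (intro sum.cong) (auto simp: eigen')
  finally show ?case .
qed

lemma poly_mat_entry:
  fixes p :: "complex poly"
  assumes "r < n" "s < n"
  shows "poly_mat p L $$ (r, s) = (\<Sum>j<n. of_real (U $$ (r, j)) * (poly p (of_real (\<mu> j)) * of_real (U $$ (s, j))))"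
proof -
  have "of_int ((L ^\<^sub>m m) $$ (r, s)) =
      (\<Sum>j<n. of_real (\<mu> j) ^ m * of_real (U $$ (r, j)) * complex_of_real (U $$ (s, j)))" for m
    using arg_cong[OF spectral_entry_pow[OF assms, of m], of complex_of_real] by simp
  hence "poly_mat p L $$ (r, s) = (\<Sum>m\<le>Polynomial.degree p. Polynomial.coeff p m *
      (\<Sum>j<n. of_real (\<mu> j) ^ m * of_real (U $$ (r, j)) * of_real (U $$ (s, j))))"
    using L_carrier assms by (simp add: poly_mat_def)
  also have "\<dots> = (\<Sum>j<n. \<Sum>m\<le>Polynomial.degree p. Polynomial.coeff p m *
      (of_real (\<mu> j) ^ m * of_real (U $$ (r, j)) * of_real (U $$ (s, j))))"
    by (simp add: sum_distrib_left) (rule sum.swap)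
  also have "\<dots> = (\<Sum>j<n. of_real (U $$ (r, j)) * (poly p (of_real (\<mu> j)) * of_real (U $$ (s, j))))"
    by (intro sum.cong) (auto simp: poly_altdef sum_distrib_left sum_distrib_right mult_ac)
  finally show ?thesis .
qed

definition minor :: "nat \<Rightarrow> (nat \<Rightarrow> nat) \<Rightarrow> (nat \<Rightarrow> nat) \<Rightarrow> real" where
  "minor k r f = det (mat k k (\<lambda>(a, b). U $$ (r a, f b)))"

text \<open>
  By the spectral decomposition, \<open>p(L)\<close> restricted to the rows and columns \<open>r\<close> factors as
  \<open>B D B\<^sup>T\<close>, where \<open>B\<close> is the submatrix of \<open>U\<close> with columns \<open>f\<close> and \<open>D\<close> is the diagonal matrix of the
  values of \<open>p\<close>; all other columns are killed by \<open>p\<close>. Squaring removes the ambiguity in the signs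
  and in the order of the columns.
\<close>

lemma det_poly_mat_eq_minor:
  fixes p :: "complex poly"
  assumes r: "r ` {..<k} \<subseteq> {..<n}" and f: "f ` {..<k} \<subseteq> {..<n}" "inj_on f {..<k}"
    and zero: "\<And>j. j < n \<Longrightarrow> j \<notin> f ` {..<k} \<Longrightarrow> poly p (of_real (\<mu> j)) = 0"
  shows "det (mat k k (\<lambda>(a, b). poly_mat p L $$ (r a, r b)))
           = of_real (minor k r f) ^ 2 * (\<Prod>b<k. poly p (of_real (\<mu> (f b))))"
proof -
  define h where "h b = poly p (of_real (\<mu> (f b)))" for b
  define B where "B = map_mat complex_of_real (mat k k (\<lambda>(a, b). U $$ (r a, f b)))"
  define D where "D = mat k k (\<lambda>(a, b). if a = b then h a else 0)"
  have carr: "B \<in> carrier_mat k k" "D \<in> carrier_mat k k" by (auto simp: B_def D_def)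
  have "det B = of_real (minor k r f)"
    unfolding B_def minor_def by (rule of_real_hom.hom_det)
  moreover have "det D = (\<Prod>b<k. h b)"
    by (subst det_upper_triangular[of _ k])
      (auto simp: D_def upper_triangular_def prod_list_diag_prod atLeast0LessThan intro!: prod.cong)
  moreover have "mat k k (\<lambda>(a, b). poly_mat p L $$ (r a, r b)) = B * (D * transpose_mat B)"
  proof (rule eq_matI)
    fix a b assume "a < dim_row (B * (D * transpose_mat B))" "b < dim_col (B * (D * transpose_mat B))"
    hence ab: "a < k" "b < k" using carr by auto
    have DB: "(D * transpose_mat B) $$ (c, b) = h c * of_real (U $$ (r b, f c))" if "c < k" for c
    proof -
      have "(D * transpose_mat B) $$ (c, b) = (\<Sum>i<k. (if c = i then h c else 0) * of_real (U $$ (r b, f i)))"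
        using that ab by (simp add: D_def B_def scalar_prod_def atLeast0LessThan)
      also have "\<dots> = (\<Sum>i<k. if c = i then h c * of_real (U $$ (r b, f c)) else 0)"
        by (rule sum.cong) auto
      finally show ?thesis using that by simp
    qed
    have "poly_mat p L $$ (r a, r b) =
        (\<Sum>j<n. of_real (U $$ (r a, j)) * (poly p (of_real (\<mu> j)) * of_real (U $$ (r b, j))))"
      using ab r by (intro poly_mat_entry) auto
    also have "\<dots> = (\<Sum>j\<in>f ` {..<k}. of_real (U $$ (r a, j)) * (poly p (of_real (\<mu> j)) * of_real (U $$ (r b, j))))"
      using f(1) zero by (intro sum.mono_neutral_right) auto
    also have "\<dots> = (\<Sum>c<k. of_real (U $$ (r a, f c)) * (h c * of_real (U $$ (r b, f c))))"
      by (simp add: sum.reindex[OF f(2)] h_def)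
    also have "\<dots> = (B * (D * transpose_mat B)) $$ (a, b)"
    proof -
      have "(B * C) $$ (a, b) = (\<Sum>c<k. B $$ (a, c) * C $$ (c, b))" if "C \<in> carrier_mat k k" for C
        using ab carr(1) that by (simp add: scalar_prod_def atLeast0LessThan)
      moreover have "B $$ (a, c) = of_real (U $$ (r a, f c))" if "c < k" for c
        using ab that by (simp add: B_def)
      ultimately show ?thesis
        using carr by (simp add: DB del: index_mult_mat)
    qed
    finally show "mat k k (\<lambda>(a, b). poly_mat p L $$ (r a, r b)) $$ (a, b) = (B * (D * transpose_mat B)) $$ (a, b)"
      using ab by simp
  qed (use carr in auto)
  moreover have "det (B * (D * transpose_mat B)) = det B * (det D * det B)"
    using carr by (simp add: det_mult[of _ k] det_transpose[of _ k])
  ultimately show ?thesis by (simp add: h_def power2_eq_square)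
qed

text \<open>
  Apply the previous lemma to the polynomials \<open>p\<close> and \<open>q\<close> whose roots are the eigenvalues not
  selected by \<open>f\<close> and by \<open>g\<close>. The homomorphism takes \<open>p\<close> to \<open>q\<close> and hence one determinant to the
  other, and \<open>q\<close> is nonzero at the eigenvalues selected by \<open>g\<close>.
\<close>

lemma minor_zero_conjugate:
  fixes K :: "complex set" and \<sigma> :: "complex \<Rightarrow> complex"
  defines "ev \<equiv> \<lambda>j. complex_of_real (\<mu> j)"
  assumes hom: "partial_ring_hom K \<sigma>" and inj_ev: "inj_on ev {..<n}"
    and E: "ev ` {..<n} \<subseteq> K" "inj_on \<sigma> (ev ` {..<n})" "\<sigma> ` ev ` {..<n} = ev ` {..<n}"
    and r: "r ` {..<k} \<subseteq> {..<n}"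
    and f: "f ` {..<k} \<subseteq> {..<n}" "inj_on f {..<k}"
    and g: "g ` {..<k} \<subseteq> {..<n}" "inj_on g {..<k}"
    and fg: "\<sigma> ` ev ` f ` {..<k} = ev ` g ` {..<k}"
    and zero: "minor k r f = 0"
  shows "minor k r g = 0"
proof -
  interpret partial_ring_hom K \<sigma> by (rule hom)
  define A where "A = ev ` {..<n} - ev ` f ` {..<k}"
  define B where "B = ev ` {..<n} - ev ` g ` {..<k}"
  define p where "p = (\<Prod>\<nu>\<in>A. [:- \<nu>, 1:])"
  define q where "q = (\<Prod>\<nu>\<in>B. [:- \<nu>, 1:])"
  have fin: "finite A" "finite B" by (auto simp: A_def B_def)
  have A: "A \<subseteq> K" "inj_on \<sigma> A" using E by (auto simp: A_def intro: inj_on_subset)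
  have img: "\<sigma> ` A = B"
    unfolding A_def B_def fg[symmetric]
    using f(1) by (subst inj_on_image_set_diff[OF E(2)]) (auto simp: E(3))
  have deg: "Polynomial.degree q = Polynomial.degree p"
    unfolding p_def q_def using card_image[OF A(2)]
    by (subst (1 2) degree_prod_eq_sum_degree) (auto simp: img)
  note coeffs = hom_coeff_prod_linear[OF fin(1) A, folded p_def, unfolded img, folded q_def]
  have entry: "poly_mat p L $$ (r a, r b) \<in> K \<and> \<sigma> (poly_mat p L $$ (r a, r b)) = poly_mat q L $$ (r a, r b)"
    if "a < k" "b < k" for a b
  proof -
    have "r a < dim_row L" "r b < dim_row L" using r L_carrier that by auto
    from hom_poly_mat[OF deg this coeffs] show ?thesis by simp
  qed
  have "det (mat k k (\<lambda>(a, b). poly_mat p L $$ (r a, r b))) = 0"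
  proof (subst det_poly_mat_eq_minor[OF r f])
    fix j assume "j < n" "j \<notin> f ` {..<k}"
    hence "ev j \<in> A"
      using inj_on_image_mem_iff[OF inj_ev, of j "f ` {..<k}"] f(1) by (auto simp: A_def)
    thus "poly p (of_real (\<mu> j)) = 0" using fin by (auto simp: p_def ev_def poly_prod)
  qed (simp add: zero)
  hence "0 = \<sigma> (det (mat k k (\<lambda>(a, b). poly_mat p L $$ (r a, r b))))" by (simp add: hom_zero)
  also have "\<dots> = det (map_mat \<sigma> (mat k k (\<lambda>(a, b). poly_mat p L $$ (r a, r b))))"
    by (rule hom_det[of _ k]) (auto simp: entry)
  also have "map_mat \<sigma> (mat k k (\<lambda>(a, b). poly_mat p L $$ (r a, r b)))
      = mat k k (\<lambda>(a, b). poly_mat q L $$ (r a, r b))"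
    by (rule eq_matI) (auto simp: entry)
  also have "det \<dots> = of_real (minor k r g) ^ 2 * (\<Prod>b<k. poly q (of_real (\<mu> (g b))))"
  proof (rule det_poly_mat_eq_minor[OF r g])
    fix j assume "j < n" "j \<notin> g ` {..<k}"
    hence "ev j \<in> B"
      using inj_on_image_mem_iff[OF inj_ev, of j "g ` {..<k}"] g(1) by (auto simp: B_def)
    thus "poly q (of_real (\<mu> j)) = 0" using fin by (auto simp: q_def ev_def poly_prod)
  qed
  finally have "of_real (minor k r g) ^ 2 * (\<Prod>b<k. poly q (of_real (\<mu> (g b)))) = 0" by simp
  moreover have "poly q (of_real (\<mu> (g b))) \<noteq> 0" if "b < k" for b
    using fin that by (auto simp: q_def poly_prod B_def ev_def)
  hence "(\<Prod>b<k. poly q (of_real (\<mu> (g b)))) \<noteq> 0" by simp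
  ultimately show ?thesis by simp
qed

text \<open>
  Orthonormality of the rows: the products with all columns recover the combination of rows as a
  vector indexed by vertices.
\<close>

lemma sum_mult_row:
  fixes r :: "nat \<Rightarrow> nat"
  assumes "r ` {..<k} \<subseteq> {..<n}" "m < k" "s < n"
  shows "(\<Sum>j<n. (\<Sum>a\<le>m. c a * U $$ (r a, j)) * U $$ (s, j)) = (\<Sum>a\<le>m. if r a = s then c a else 0)"
proof -
  have "(\<Sum>j<n. (\<Sum>a\<le>m. c a * U $$ (r a, j)) * U $$ (s, j))
      = (\<Sum>a\<le>m. c a * (\<Sum>j<n. U $$ (r a, j) * U $$ (s, j)))"
    by (simp add: sum_distrib_left sum_distrib_right mult.assoc) (rule sum.swap)
  also have "\<dots> = (\<Sum>a\<le>m. if r a = s then c a else 0)"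
  proof (intro sum.cong refl)
    fix a assume "a \<in> {..m}"
    hence "a \<in> {..<k}" using assms(2) by simp
    hence "r a < n" using assms(1) by blast
    thus "c a * (\<Sum>j<n. U $$ (r a, j) * U $$ (s, j)) = (if r a = s then c a else 0)"
      using assms(3) by (simp add: rows_orthonormal)
  qed
  finally show ?thesis .
qed

lemma row_coefficient:
  fixes r :: "nat \<Rightarrow> nat"
  assumes r: "r ` {..<k} \<subseteq> {..<n}" "inj_on r {..<k}" and m: "m < k"
  shows "(\<Sum>j<n. (\<Sum>a\<le>m. c a * U $$ (r a, j)) * U $$ (r m, j)) = c m"
proof -
  have "(\<Sum>a\<le>m. if r a = r m then c a else 0) = (\<Sum>a\<le>m. if a = m then c a else 0)"
  proof (intro sum.cong refl)
    fix a assume "a \<in> {..m}"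
    hence "r a = r m \<longleftrightarrow> a = m" using m by (intro inj_on_eq_iff[OF r(2)]) auto
    thus "(if r a = r m then c a else 0) = (if a = m then c a else 0)" by simp
  qed
  thus ?thesis using r m by (subst sum_mult_row[OF r(1) m]) auto
qed

lemma exists_nonzero_minor_UNIV:
  assumes r: "r ` {..<k} \<subseteq> {..<n}" "inj_on r {..<k}" and j0: "j0 < n" "U $$ (r 0, j0) \<noteq> 0"
    and k: "0 < k"
  shows "\<exists>f. f ` {..<k} \<subseteq> {..<n} \<and> f 0 = j0 \<and> minor k r f \<noteq> 0"
proof -
  have "\<exists>f. f ` {..<k} \<subseteq> {..<n} \<and> (\<forall>i<1. f i = j0) \<and> det (mat k k (\<lambda>(a, b). U $$ (r a, f b))) \<noteq> 0"
  proof (rule exists_nonzero_minor)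
    show "det (mat 1 1 (\<lambda>(a, b). U $$ (r a, j0))) \<noteq> 0" using j0 by (simp add: det_single)
    show "(\<lambda>_. j0) ` {..<1} \<subseteq> {..<n}" "1 \<le> k" using j0 k by auto
    fix m c assume m: "m < k" and c: "\<And>j. j \<in> {..<n} \<Longrightarrow> (\<Sum>a\<le>m. c a * U $$ (r a, j)) = 0"
    have "c m = (\<Sum>j<n. (\<Sum>a\<le>m. c a * U $$ (r a, j)) * U $$ (r m, j))"
      by (rule row_coefficient[symmetric, OF r m])
    thus "c m = 0" by (simp add: c)
  qed
  thus ?thesis by (auto simp: minor_def)
qed

text \<open>
  A combination of the rows that vanishes in every column except \<open>j0\<close> is, read as a vector on the
  vertices, a multiple of the column \<open>j0\<close>. It is supported on fewer than \<open>n\<close> vertices while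
  the column \<open>j0\<close> has full support, so the multiple is zero.
\<close>

lemma exists_nonzero_minor_avoiding:
  assumes r: "r ` {..<k} \<subseteq> {..<n}" "inj_on r {..<k}" and k: "k < n"
    and j0: "j0 < n" "\<And>s. s < n \<Longrightarrow> U $$ (s, j0) \<noteq> 0"
  shows "\<exists>f. f ` {..<k} \<subseteq> {..<n} - {j0} \<and> minor k r f \<noteq> 0"
proof -
  have "\<exists>f. f ` {..<k} \<subseteq> {..<n} - {j0} \<and> (\<forall>i<0. f i = undefined i) \<and>
      det (mat k k (\<lambda>(a, b). U $$ (r a, f b))) \<noteq> 0"
  proof (rule exists_nonzero_minor)
    show "det (mat 0 0 (\<lambda>(a, b). U $$ (r a, undefined b))) \<noteq> 0" by (simp add: det_dim_zero)
    show "undefined ` {..<0::nat} \<subseteq> {..<n} - {j0}" "0 \<le> k" by auto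
    fix m c assume m: "m < k"
      and c: "\<And>j. j \<in> {..<n} - {j0} \<Longrightarrow> (\<Sum>a\<le>m. c a * U $$ (r a, j)) = 0"
    define \<kappa> where "\<kappa> = (\<Sum>a\<le>m. c a * U $$ (r a, j0))"
    have only: "(\<Sum>j<n. (\<Sum>a\<le>m. c a * U $$ (r a, j)) * U $$ (s, j)) = \<kappa> * U $$ (s, j0)" for s
      using j0(1) by (subst sum.remove[of _ j0]) (auto simp: c \<kappa>_def)
    have "card (r ` {..m}) < card {..<n}"
      using card_image_le[of "{..m}" r] m k by simp
    then obtain s where s: "s < n" "s \<notin> r ` {..m}"
      by (metis card_mono finite_atMost finite_imageI lessThan_iff not_le subsetI)
    have "\<kappa> * U $$ (s, j0) = (\<Sum>a\<le>m. if r a = s then c a else 0)"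
      by (rule trans[OF only[symmetric] sum_mult_row[OF r(1) m s(1)]])
    also have "\<dots> = 0" using s(2) by (intro sum.neutral) auto
    finally have "\<kappa> = 0" using j0(2)[OF s(1)] by simp
    thus "c m = 0" using row_coefficient[OF r m, of c] only[of "r m"] by simp
  qed
  thus ?thesis by (auto simp: minor_def)
qed

text \<open>
  The all-ones vector lies in the kernel of \<open>L\<close>, so it is orthogonal to every column with a nonzero
  eigenvalue, and expanding it in the orthonormal basis exhibits it as a multiple of the column
  \<open>j0\<close>. A zero entry of that column would contradict an entry \<open>1\<close>.
\<close>

lemma kernel_column_nonzero:
  assumes sums: "\<And>r. r < n \<Longrightarrow> (\<Sum>s<n. L $$ (r, s)) = 0"
    and j0: "j0 < n" "\<And>j. j < n \<Longrightarrow> j \<noteq> j0 \<Longrightarrow> \<mu> j \<noteq> 0" and s: "s < n"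
  shows "U $$ (s, j0) \<noteq> 0"
proof
  assume zero: "U $$ (s, j0) = 0"
  have "(\<Sum>t<n. U $$ (t, j)) = 0" if j: "j < n" "j \<noteq> j0" for j
  proof -
    have "\<mu> j * (\<Sum>t<n. U $$ (t, j)) = (\<Sum>t<n. \<Sum>i<n. of_int (L $$ (t, i)) * U $$ (i, j))"
      using eigen j by (simp add: sum_distrib_left)
    also have "\<dots> = (\<Sum>t<n. \<Sum>i<n. of_int (L $$ (i, t)) * U $$ (i, j))"
      by (intro sum.cong) (auto simp: spectral_entry mult_ac)
    also have "\<dots> = (\<Sum>i<n. (\<Sum>t<n. of_int (L $$ (i, t))) * U $$ (i, j))"
      by (subst sum.swap) (simp add: sum_distrib_right)
    also have "\<dots> = 0"
    proof (intro sum.neutral ballI)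
      fix i assume "i \<in> {..<n}"
      thus "(\<Sum>t<n. of_int (L $$ (i, t))) * U $$ (i, j) = 0"
        using sums[of i] by (simp flip: of_int_sum)
    qed
    finally show ?thesis using j0(2)[OF j] by simp
  qed
  hence "(\<Sum>j<n. U $$ (s, j) * (\<Sum>t<n. U $$ (t, j))) = 0"
    using zero by (intro sum.neutral) auto
  moreover have "(\<Sum>j<n. U $$ (s, j) * (\<Sum>t<n. U $$ (t, j))) = (\<Sum>t<n. \<Sum>j<n. U $$ (s, j) * U $$ (t, j))"
    by (simp add: sum_distrib_left) (rule sum.swap)
  moreover have "\<dots> = (\<Sum>t<n. if s = t then 1 else 0)"
    using s by (intro sum.cong) (auto simp: rows_orthonormal)
  ultimately show False using s by simp
qed

lemma char_poly_eq_prod: "map_poly real_of_int (char_poly L) = (\<Prod>j<n. [:- \<mu> j, 1:])"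
proof -
  define D where "D = mat n n (\<lambda>(i, j). if i = j then \<mu> i else 0)"
  define LR where "LR = map_mat real_of_int L"
  have carr: "D \<in> carrier_mat n n" "LR \<in> carrier_mat n n" using L_carrier by (auto simp: D_def LR_def)
  have UD: "(U * D) $$ (r, s) = \<mu> s * U $$ (r, s)" if "r < n" "s < n" for r s
  proof -
    have "(U * D) $$ (r, s) = (\<Sum>i<n. U $$ (r, i) * (if i = s then \<mu> i else 0))"
      using that U_carrier by (simp add: D_def scalar_prod_def atLeast0LessThan)
    also have "\<dots> = (\<Sum>i<n. if i = s then \<mu> s * U $$ (r, s) else 0)"
      by (rule sum.cong) auto
    finally show ?thesis using that by simp
  qed
  have "LR * U = U * D"
  proof (rule eq_matI)
    fix r s assume "r < dim_row (U * D)" "s < dim_col (U * D)"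
    hence rs: "r < n" "s < n" using U_carrier by (auto simp: D_def)
    have "(LR * U) $$ (r, s) = \<mu> s * U $$ (r, s)"
      using eigen[OF rs] rs U_carrier L_carrier by (simp add: LR_def scalar_prod_def atLeast0LessThan)
    thus "(LR * U) $$ (r, s) = (U * D) $$ (r, s)" using UD[OF rs] by simp
  qed (use carr U_carrier in auto)
  hence "LR * U * transpose_mat U = U * D * transpose_mat U" by simp
  moreover have "LR * U * transpose_mat U = LR * (U * transpose_mat U)"
    using carr U_carrier by (intro assoc_mult_mat) auto
  ultimately have eq: "LR = U * D * transpose_mat U"
    using carr by (simp add: mult_transpose_self)
  have "similar_mat LR D"
    by (rule similar_matI[of _ _ U "transpose_mat U" n])
      (use carr U_carrier mult_transpose_self transpose_mult_self eq in auto)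
  hence "char_poly LR = char_poly D" by (rule char_poly_similar)
  also have "\<dots> = (\<Prod>a\<leftarrow>diag_mat D. [:- a, 1:])"
    by (rule char_poly_upper_triangular[OF carr(1)]) (auto simp: D_def upper_triangular_def)
  also have "\<dots> = (\<Prod>j<n. [:- \<mu> j, 1:])"
    by (simp add: diag_mat_def D_def o_def prod.distinct_set_conv_list[symmetric] atLeast0LessThan
        cong: map_cong)
  also have "char_poly LR = map_poly real_of_int (char_poly L)"
    unfolding LR_def by (rule of_int_hom.char_poly_hom[OF L_carrier])
  finally show ?thesis .
qed

text \<open>
  The root set is taken in the complex numbers because the Galois group acts there, although all
  eigenvalues are real.
\<close>

lemma complex_char_poly_roots:
  "{z. poly (map_poly of_int (char_poly L)) z = 0} = (\<lambda>j. complex_of_real (\<mu> j)) ` {..<n}"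
proof -
  interpret h: map_poly_comm_ring_hom complex_of_real ..
  have "map_poly (of_int :: int \<Rightarrow> complex) (char_poly L)
      = map_poly complex_of_real (map_poly real_of_int (char_poly L))"
    by (subst map_poly_map_poly) (auto simp: o_def)
  also have "\<dots> = (\<Prod>j<n. [:- of_real (\<mu> j), 1:])"
    by (simp add: char_poly_eq_prod h.hom_prod)
  finally show ?thesis by (auto simp: poly_prod)
qed

end

section \<open>Minors and the uncertainty inequality\<close>

lemma bij_betw_pick:
  assumes "finite I"
  shows "bij_betw (pick I) {..<card I} I"
proof -
  have "inj_on (pick I) {..<card I}"
    by (rule linorder_inj_onI) (auto dest: pick_mono_le[of _ I])
  moreover have "pick I ` {..<card I} \<subseteq> I" using pick_in_set_le by auto
  ultimately show ?thesis
    using assms card_subset_eq[of I "pick I ` {..<card I}"] by (simp add: bij_betw_def card_image)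
qed

lemma submatrix_eq_mat:
  assumes "U \<in> carrier_mat n m" "I \<subseteq> {0..<n}" "J \<subseteq> {0..<m}"
  shows "submatrix U I J = mat (card I) (card J) (\<lambda>(a, b). U $$ (pick I a, pick J b))"
proof -
  have "{i. i < n \<and> i \<in> I} = I" "{j. j < m \<and> j \<in> J} = J" using assms by auto
  thus ?thesis using assms(1) by (simp add: submatrix_def)
qed

text \<open>
  If the zero set \<open>Z\<close> of the transform had at least as many elements as the support \<open>I\<close> of \<open>f\<close>, the
  transpose of a square submatrix with rows \<open>I\<close> and columns from \<open>Z\<close> would map the nonzero
  restriction of \<open>f\<close> to zero.
\<close>

lemma uncertainty_of_nonzero_minors:
  assumes U: "U \<in> carrier_mat n n"
    and minors: "\<And>I J. I \<subseteq> {0..<n} \<Longrightarrow> J \<subseteq> {0..<n} \<Longrightarrow> card I = card J \<Longrightarrow> det (submatrix U I J) \<noteq> 0"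
    and f: "f \<in> carrier_vec n" "f \<noteq> 0\<^sub>v n"
  shows "norm0 f + norm0 (graph_fourier U f) \<ge> n + 1"
proof -
  define I where "I = {i. i < n \<and> f $ i \<noteq> 0}"
  define Z where "Z = {j. j < n \<and> graph_fourier U f $ j = 0}"
  define k where "k = card I"
  have fin: "finite I" "finite Z" by (auto simp: I_def Z_def)
  have pos: "0 < k"
    unfolding k_def using f by (subst card_gt_0_iff) (auto simp: I_def)
  have "card Z < k"
  proof (rule ccontr)
    assume "\<not> card Z < k"
    then obtain J where J: "J \<subseteq> Z" "card J = k" "finite J"
      using obtain_subset_with_card_n[of k Z] by auto
    have sub: "I \<subseteq> {0..<n}" "J \<subseteq> {0..<n}" using J(1) by (auto simp: I_def Z_def)
    define A where "A = submatrix U I J"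
    have A: "A = mat k k (\<lambda>(a, b). U $$ (pick I a, pick J b))"
      unfolding A_def using submatrix_eq_mat[OF U sub] J(2) by (simp add: k_def)
    hence carr: "transpose_mat A \<in> carrier_mat k k" by simp
    define v where "v = vec k (\<lambda>a. f $ pick I a)"
    have bij: "bij_betw (pick I) {..<k} I" unfolding k_def by (rule bij_betw_pick[OF fin(1)])
    have "transpose_mat A *\<^sub>v v = 0\<^sub>v k"
    proof (rule eq_vecI)
      fix b assume "b < dim_vec (0\<^sub>v k)"
      hence b: "b < k" by simp
      have Jb: "pick J b \<in> Z" using pick_in_set_le[of b J] b J by auto
      have "(transpose_mat A *\<^sub>v v) $ b = (\<Sum>a<k. U $$ (pick I a, pick J b) * f $ pick I a)"
        using b by (simp add: A v_def scalar_prod_def atLeast0LessThan)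
      also have "\<dots> = (\<Sum>i\<in>I. U $$ (i, pick J b) * f $ i)"
        by (rule sum.reindex_bij_betw[OF bij])
      also have "\<dots> = (\<Sum>i<n. U $$ (i, pick J b) * f $ i)"
        by (rule sum.mono_neutral_left) (auto simp: I_def)
      also have "\<dots> = graph_fourier U f $ pick J b"
      proof -
        have "pick J b < n" using Jb by (simp add: Z_def)
        thus ?thesis using U f by (simp add: graph_fourier_def scalar_prod_def atLeast0LessThan)
      qed
      finally show "(transpose_mat A *\<^sub>v v) $ b = 0\<^sub>v k $ b" using Jb b by (simp add: Z_def)
    qed (use carr in auto)
    moreover have "det (transpose_mat A) \<noteq> 0"
      using minors[OF sub] J(2) A by (subst det_transpose[of _ k]) (auto simp: k_def A_def)
    moreover have "v \<in> carrier_vec k" by (simp add: v_def)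
    ultimately have "v = 0\<^sub>v k" using det_0_iff_vec_prod_zero_field[OF carr] by blast
    hence "v $ 0 = 0" using pos by simp
    thus False using pos pick_in_set_le[of 0 I] by (simp add: v_def k_def I_def)
  qed
  moreover have "norm0 (graph_fourier U f) = n - card Z"
  proof -
    have "{j. j < dim_vec (graph_fourier U f) \<and> graph_fourier U f $ j \<noteq> 0} = {..<n} - Z"
      using U by (auto simp: Z_def graph_fourier_def)
    moreover have "Z \<subseteq> {..<n}" by (auto simp: Z_def)
    ultimately show ?thesis by (simp add: norm0_def card_Diff_subset fin)
  qed
  moreover have "norm0 f = k" using f by (simp add: norm0_def k_def I_def)
  moreover have "k \<le> n" using card_mono[of "{..<n}" I] by (auto simp: k_def I_def)
  ultimately show ?thesis by linarith
qed

section \<open>Galois automorphisms and Laplacians\<close>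

lemma a_inv_ring_of_type_algebra: "a_inv (ring_of_type_algebra :: 'a::field ring) x = - x"
proof -
  interpret R: field "ring_of_type_algebra :: 'a ring" by (rule field_from_type_algebra)
  show ?thesis by (rule R.minus_equality) (auto simp: ring_of_type_algebra_def)
qed

lemma galois_group_partial_ring_hom:
  assumes "\<sigma> \<in> galois_group p"
  shows "partial_ring_hom (carrier (splitting_field p)) \<sigma>"
proof -
  let ?H = "\<rat> \<union> complex_roots p"
  let ?K = "generate_field ring_of_type_algebra ?H"
  have simps: "carrier (splitting_field p) = ?K" "one (splitting_field p) = 1"
    "mult (splitting_field p) = (*)" "add (splitting_field p) = (+)"
    by (auto simp: splitting_field_def ring_of_type_algebra_def)
  have hom: "\<sigma> \<in> ring_hom (splitting_field p) (splitting_field p)"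
    using assms by (auto simp: galois_group_def ring_iso_def)
  have ops: "one ring_of_type_algebra = (1::complex)" "mult ring_of_type_algebra = ((*) :: complex \<Rightarrow> _)"
    "add ring_of_type_algebra = ((+) :: complex \<Rightarrow> _)"
    by (auto simp: ring_of_type_algebra_def)
  show ?thesis
    unfolding simps(1)
  proof
    show "1 \<in> ?K" using generate_field.one[of ring_of_type_algebra ?H] by (simp add: ops)
    show "- x \<in> ?K" if "x \<in> ?K" for x
      using generate_field.a_inv[OF that] by (simp add: a_inv_ring_of_type_algebra)
    show "x + y \<in> ?K" "x * y \<in> ?K" if "x \<in> ?K" "y \<in> ?K" for x y
      using generate_field.eng_add[OF that] generate_field.eng_mult[OF that] by (simp_all add: ops)
    show "\<sigma> 1 = 1" using ring_hom_one[OF hom] by (simp add: simps)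
    show "\<sigma> (x + y) = \<sigma> x + \<sigma> y" "\<sigma> (x * y) = \<sigma> x * \<sigma> y" if "x \<in> ?K" "y \<in> ?K" for x y
      using ring_hom_add[OF hom, of x y] ring_hom_mult[OF hom, of x y] that by (simp_all add: simps)
  qed
qed

lemma galois_perms_extend:
  assumes "\<pi> \<in> galois_perms p"
  obtains K \<sigma> where "partial_ring_hom K \<sigma>" "complex_roots p \<subseteq> K" "\<And>z. z \<in> complex_roots p \<Longrightarrow> \<sigma> z = \<pi> z"
proof -
  from assms obtain \<sigma> where \<sigma>: "\<sigma> \<in> galois_group p" "\<pi> = restrict_id \<sigma> (complex_roots p)"
    by (auto simp: galois_perms_def)
  show ?thesis
  proof
    show "partial_ring_hom (carrier (splitting_field p)) \<sigma>"
      by (rule galois_group_partial_ring_hom[OF \<sigma>(1)])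
    show "complex_roots p \<subseteq> carrier (splitting_field p)"
      by (auto simp: splitting_field_def intro: generate_field.incl)
  qed (simp add: \<sigma>(2))
qed

lemma laplacian_mat_row_sum:
  assumes "pair_graph G" "pverts G = {0..<n}" "r < n"
  shows "(\<Sum>s<n. laplacian_mat n G $$ (r, s)) = 0"
proof -
  interpret pair_graph G by (rule assms(1))
  have "out_arcs (with_proj G) r = Pair r ` {s. s < n \<and> (r, s) \<in> parcs G}"
    using in_arcsD2 assms(2) by (auto simp: out_arcs_def image_iff)
  hence deg: "out_degree (with_proj G) r = card {s. s < n \<and> (r, s) \<in> parcs G}"
    by (simp add: out_degree_def card_image inj_on_def)
  have "(\<Sum>s<n. laplacian_mat n G $$ (r, s))
      = (\<Sum>s<n. if r = s then int (out_degree (with_proj G) r) else 0)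
        - (\<Sum>s<n. if (r, s) \<in> parcs G then 1 else 0)"
    using assms(3) by (simp add: laplacian_mat_def degree_mat_def adjacency_mat_def sum_subtractf)
  also have "(\<Sum>s<n. if (r, s) \<in> parcs G then 1 else (0::int)) = int (card {s. s < n \<and> (r, s) \<in> parcs G})"
    by (simp add: sum.If_cases Int_def)
  finally show ?thesis using assms(3) deg by simp
qed

lemma complex_roots_map_poly_of_int:
  "complex_roots (map_poly of_int p) = {z. poly (map_poly of_int p) z = 0}"
proof -
  have "map_poly of_rat (map_poly of_int p) = map_poly (of_int :: int \<Rightarrow> complex) p"
    by (subst map_poly_map_poly) (auto simp: o_def)
  thus ?thesis by (simp add: complex_roots_def)
qed


theorem theorem5:
  fixes n :: nat and G :: "nat pair_pre_digraph"
    and \<xi> :: "int poly" and U :: "real mat"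
  assumes graph: "pair_graph G" "pverts G = {0..<n}"
    and char_poly: "char_poly (laplacian_mat n G) = [:0, 1:] * \<xi>"
    and U: "orthonormal_eigenvector_mat n (map_mat of_int (laplacian_mat n G)) U"
    and distinct_roots: "card (complex_roots (map_poly of_int \<xi>)) = n - 1"
    and galois: "alternating_perms (complex_roots (map_poly of_int \<xi>))
                   \<subseteq> galois_perms (map_poly of_int \<xi>)"
    and order_3: "n \<noteq> 3"
    and order_2: "n = 2 \<Longrightarrow> parcs G \<noteq> {}"
  shows "(\<forall>I J. I \<subseteq> {0..<n} \<and> J \<subseteq> {0..<n} \<and> card I = card J
            \<longrightarrow> det (submatrix U I J) \<noteq> 0) \<and>
         (\<forall>f \<in> carrier_vec n. f \<noteq> 0\<^sub>v n
            \<longrightarrow> norm0 f + norm0 (graph_fourier U f) \<ge> n + 1)"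
proof -
  define L where "L = laplacian_mat n G"
  define R where "R = complex_roots (map_poly of_int \<xi>)"
  have L: "L \<in> carrier_mat n n"
    unfolding L_def laplacian_mat_def by (intro minus_carrier_mat) (simp add: adjacency_mat_def)
  have U_carrier: "U \<in> carrier_mat n n" using U by (simp add: orthonormal_eigenvector_mat_def)
  have "\<forall>j\<in>{..<n}. \<exists>\<mu>. eigenvector (map_mat real_of_int L) (col U j) \<mu>"
    using U by (simp add: orthonormal_eigenvector_mat_def L_def)
  then obtain \<mu> where \<mu>: "eigenvector (map_mat real_of_int L) (col U j) (\<mu> j)" if "j < n" for j
    by (metis lessThan_iff)
  interpret orthonormal_eigenbasis n L U \<mu>
  proof
    fix i j assume "i < n" "j < n"
    thus "(\<Sum>s<n. U $$ (s, i) * U $$ (s, j)) = (if i = j then 1 else 0)"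
      using U U_carrier by (auto simp: orthonormal_eigenvector_mat_def scalar_prod_def atLeast0LessThan)
  next
    fix r j assume rj: "r < n" "j < n"
    have "(map_mat real_of_int L *\<^sub>v col U j) $ r = (\<mu> j \<cdot>\<^sub>v col U j) $ r"
      using \<mu>[OF rj(2)] by (simp add: eigenvector_def)
    thus "(\<Sum>s<n. of_int (L $$ (r, s)) * U $$ (s, j)) = \<mu> j * U $$ (r, j)"
      using rj L U_carrier by (simp add: scalar_prod_def atLeast0LessThan)
  qed (use L U_carrier in auto)
  define ev where "ev j = complex_of_real (\<mu> j)" for j
  have "map_poly complex_of_int (char_poly L) = pCons 0 (map_poly of_int \<xi>)"
    unfolding L_def char_poly
    by (rule poly_eqI) (simp add: coeff_map_poly coeff_pCons split: nat.split)
  hence "{z. poly (map_poly complex_of_int (char_poly L)) z = 0} = insert 0 R"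
    by (auto simp: R_def complex_roots_map_poly_of_int)
  hence evs: "ev ` {..<n} = insert 0 R"
    unfolding complex_char_poly_roots ev_def .
  hence n: "0 < n" by (cases n) auto
  have fin: "finite R" using evs by (metis finite_imageI finite_insert finite_lessThan)
  have cR: "card R = n - 1" using distinct_roots by (simp add: R_def)

  have extend: "\<exists>K \<sigma>. partial_ring_hom K \<sigma> \<and> R \<subseteq> K \<and> inj_on \<sigma> R \<and> \<sigma> ` R = R \<and> \<sigma> ` S = S'"
    if S: "S \<subseteq> R" "S' \<subseteq> R" "card S = card S'" for S S'
  proof -
    have "card R \<noteq> 2" using cR order_3 by auto
    then obtain \<pi> where \<pi>: "\<pi> \<in> alternating_perms R" "\<pi> ` S = S'"
      using alternating_perms_homogeneous[OF fin _ S] by blast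
    obtain K \<sigma> where \<sigma>: "partial_ring_hom K \<sigma>" "R \<subseteq> K" "\<And>z. z \<in> R \<Longrightarrow> \<sigma> z = \<pi> z"
      using galois \<pi>(1) unfolding R_def by (metis galois_perms_extend subsetD)
    have perm: "\<pi> permutes R" using \<pi>(1) by (simp add: alternating_perms_def)
    have "inj_on \<sigma> R" using permutes_inj_on[OF perm, of R] \<sigma>(3) by (simp cong: inj_on_cong)
    moreover have "\<sigma> ` R = R" using permutes_image[OF perm] \<sigma>(3) by (simp cong: image_cong)
    moreover have "\<sigma> ` S = S'"
      unfolding \<pi>(2)[symmetric] using \<sigma>(3) S(1) by (intro image_cong) auto
    ultimately show ?thesis using \<sigma>(1,2) by blast
  qed

  (* Automorphisms fix 0, but homogeneity moves it whenever there is another root. A lone root 0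
     can occur only for n = 2; then all eigenvalues vanish, so L = 0 and the graph has no edge. *)
  have zero_R: "0 \<notin> R"
  proof
    assume 0: "0 \<in> R"
    show False
    proof (cases "card R = 1")
      case True
      then obtain x where "R = {x}" by (rule card_1_singletonE)
      hence "ev ` {..<n} = {0}" using 0 evs by simp
      hence \<mu>0: "\<mu> j = 0" if "j < n" for j
        using that imageI[of j "{..<n}" ev] by (simp add: ev_def)
      have "n = 2" using True cR by simp
      then obtain u v where uv: "(u, v) \<in> parcs G" using order_2 by auto
      interpret G: pair_graph G by (rule graph(1))
      have "u < n" "v < n" "u \<noteq> v"
        using uv G.in_arcsD1[OF uv] G.in_arcsD2[OF uv] G.pair_no_loops[OF uv] graph(2) by auto
      hence "L $$ (u, v) = -1"
        using uv by (simp add: L_def laplacian_mat_def degree_mat_def adjacency_mat_def)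
      thus False using spectral_entry[OF \<open>u < n\<close> \<open>v < n\<close>] \<mu>0 by simp
    next
      case False
      hence "R \<noteq> {0}" by auto
      then obtain x where x: "x \<in> R" "x \<noteq> 0" using 0 by blast
      have "{0} \<subseteq> R" "{x} \<subseteq> R" "card {0::complex} = card {x}" using 0 x by auto
      from extend[OF this] obtain K \<sigma> where \<sigma>: "partial_ring_hom K \<sigma>" "\<sigma> ` {0::complex} = {x}"
        by blast
      from \<sigma>(2) show False using partial_ring_hom.hom_zero[OF \<sigma>(1)] x(2) by simp
    qed
  qed

  have inj_ev: "inj_on ev {..<n}"
    using evs zero_R fin cR n by (intro eq_card_imp_inj_on) auto
  obtain j0 where j0: "j0 < n" "ev j0 = 0" using evs by (metis imageE insertI1 lessThan_iff)
  have ev_0: "ev j = 0 \<longleftrightarrow> j = j0" if "j < n" for j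
    using inj_ev j0 that by (auto simp: inj_on_def)
  have col_j0: "U $$ (s, j0) \<noteq> 0" if "s < n" for s
  proof (rule kernel_column_nonzero[OF _ j0(1) _ that])
    show "(\<Sum>s<n. L $$ (r, s)) = 0" if "r < n" for r
      unfolding L_def by (rule laplacian_mat_row_sum[OF graph that])
    show "\<mu> j \<noteq> 0" if "j < n" "j \<noteq> j0" for j using ev_0[OF that(1)] that(2) by (auto simp: ev_def)
  qed

  (* The eigenvalue 0 is fixed by every automorphism, so only the selected nonzero eigenvalues
     can be moved; the two selections must agree on the column j0. *)
  have transfer: "minor k r g = 0"
    if r: "r ` {..<k} \<subseteq> {..<n}"
      and f: "f ` {..<k} \<subseteq> {..<n}" "inj_on f {..<k}" and g: "g ` {..<k} \<subseteq> {..<n}" "inj_on g {..<k}"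
      and j0_fg: "j0 \<in> f ` {..<k} \<longleftrightarrow> j0 \<in> g ` {..<k}" and zero: "minor k r f = 0" for k r f g
  proof -
    define S where "S = ev ` f ` {..<k}"
    define S' where "S' = ev ` g ` {..<k}"
    have card: "card S = k" "card S' = k"
      unfolding S_def S'_def
      using f(2) g(2) inj_on_subset[OF inj_ev f(1)] inj_on_subset[OF inj_ev g(1)]
      by (simp_all add: card_image)
    have "0 \<in> S \<longleftrightarrow> j0 \<in> f ` {..<k}"
      using inj_on_image_mem_iff[OF inj_ev _ f(1), of j0] j0 by (simp only: S_def lessThan_iff)
    moreover have "0 \<in> S' \<longleftrightarrow> j0 \<in> g ` {..<k}"
      using inj_on_image_mem_iff[OF inj_ev _ g(1), of j0] j0 by (simp only: S'_def lessThan_iff)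
    ultimately have 0: "0 \<in> S \<longleftrightarrow> 0 \<in> S'" using j0_fg by (simp only:)
    have "S \<subseteq> insert 0 R" "S' \<subseteq> insert 0 R"
      unfolding S_def S'_def evs[symmetric] by (intro image_mono f(1) g(1))+
    hence sub: "S - {0} \<subseteq> R" "S' - {0} \<subseteq> R" by blast+
    have "card (S - {0}) = card (S' - {0})" using card 0 by (simp add: card_Diff_singleton_if)
    from extend[OF sub this] obtain K \<sigma> where \<sigma>: "partial_ring_hom K \<sigma>" "R \<subseteq> K" "inj_on \<sigma> R" "\<sigma> ` R = R"
      "\<sigma> ` (S - {0}) = S' - {0}"
      by blast
    interpret partial_ring_hom K \<sigma> by (rule \<sigma>(1))
    have SS': "\<sigma> ` S = S'"
    proof (cases "0 \<in> S")
      case True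
      hence "\<sigma> ` S = insert (\<sigma> 0) (\<sigma> ` (S - {0}))" by (metis image_insert insert_Diff)
      thus ?thesis using True 0 by (simp add: \<sigma>(5) hom_zero insert_absorb)
    next
      case False
      thus ?thesis using \<sigma>(5) 0 by simp
    qed
    show ?thesis
    proof (rule minor_zero_conjugate[OF \<sigma>(1) _ _ _ _ r f g _ zero, folded ev_def])
      show "ev ` {..<n} \<subseteq> K" using \<sigma>(2) zero_closed evs by auto
      show "inj_on \<sigma> (ev ` {..<n})" using \<sigma>(3,4) zero_R by (simp add: evs hom_zero)
      show "\<sigma> ` ev ` {..<n} = ev ` {..<n}" using \<sigma>(4) by (simp add: evs hom_zero)
      show "\<sigma> ` ev ` f ` {..<k} = ev ` g ` {..<k}" using SS' by (simp only: S_def S'_def)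
    qed (rule inj_ev)
  qed

  have minors: "det (submatrix U I J) \<noteq> 0"
    if IJ: "I \<subseteq> {0..<n}" "J \<subseteq> {0..<n}" "card I = card J" for I J
  proof
    assume "det (submatrix U I J) = 0"
    define k where "k = card I"
    have finIJ: "finite I" "finite J" using IJ finite_subset by auto
    have r: "pick I ` {..<k} = I" "inj_on (pick I) {..<k}"
      and f: "pick J ` {..<k} = J" "inj_on (pick J) {..<k}"
      using bij_betw_pick[OF finIJ(1)] bij_betw_pick[OF finIJ(2)] IJ(3) by (simp_all add: k_def bij_betw_def)
    have r': "pick I ` {..<k} \<subseteq> {..<n}" and f': "pick J ` {..<k} \<subseteq> {..<n}"
      using r f IJ by auto
    have zero: "minor k (pick I) (pick J) = 0"
      using \<open>det (submatrix U I J) = 0\<close> submatrix_eq_mat[OF U_carrier IJ(1,2)] IJ(3)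
      by (simp add: minor_def k_def)
    have "\<exists>g. g ` {..<k} \<subseteq> {..<n} \<and> (j0 \<in> g ` {..<k} \<longleftrightarrow> j0 \<in> J) \<and> minor k (pick I) g \<noteq> 0"
    proof (cases "j0 \<in> J")
      case True
      hence k: "0 < k" using f(1) by (cases k) auto
      have "pick I 0 < n" using r' k by auto
      from exists_nonzero_minor_UNIV[OF r' r(2) j0(1) col_j0[OF this] k] True k
      show ?thesis by (metis image_eqI lessThan_iff)
    next
      case False
      have "J \<subset> {0..<n}" using IJ(2) j0(1) False by auto
      hence "k < n" using psubset_card_mono[of "{0..<n}" J] IJ(3) by (simp add: k_def)
      from exists_nonzero_minor_avoiding[OF r' r(2) this j0(1) col_j0] False
      show ?thesis by blast
    qed
    then obtain g where g: "g ` {..<k} \<subseteq> {..<n}" "j0 \<in> g ` {..<k} \<longleftrightarrow> j0 \<in> J" "minor k (pick I) g \<noteq> 0"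
      by blast
    have "inj_on g {..<k}"
      by (rule inj_on_nonzero_minor[where V = "\<lambda>a j. U $$ (pick I a, j)"])
        (use g(3) in \<open>simp add: minor_def\<close>)
    from transfer[OF r' f' f(2) g(1) this _ zero] g f(1) show False by simp
  qed
  show ?thesis
  proof (intro conjI allI impI ballI)
    show "det (submatrix U I J) \<noteq> 0" if "I \<subseteq> {0..<n} \<and> J \<subseteq> {0..<n} \<and> card I = card J" for I J
      using minors that by simp
    show "norm0 f + norm0 (graph_fourier U f) \<ge> n + 1" if "f \<in> carrier_vec n" "f \<noteq> 0\<^sub>v n" for f
      using uncertainty_of_nonzero_minors[OF U_carrier minors that] .
  qed
qed

end
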